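(* Let $G$ be a split graph, with vertex set partitioned as $V(G)=C_G\cup I_G$ where $C_G$ is a clique and $I_G$ is an independent set. Then $\mathcal{R}(G)$ is connected and has diameter at most $2|I_G|+1$.
   Context: All graphs are finite, simple and undirected; $N(v)$ denotes the open neighbourhood of $v$. A set $S\subseteq V(G)$ is a dominating set if every vertex of $G$ is in $S$ or adjacent to a vertex of $S$; it is a minimal dominating set if no proper subset of $S$ is a dominating set. The reconfiguration graph $\mathcal{R}(G)$ has as vertex set the collection of all minimal dominating sets of $G$, and two minimal dominating sets $M_1,M_2$ are adjacent iff there is a vertex $v$ with either ($M_2\setminus M_1=\{v\}$ and $M_1\setminus M_2\subseteq N(v)$) or ($M_1\setminus M_2=\{v\}$ and $M_2\setminus M_1\subseteq N(v)$). A split graph is a graph whose vertex set can be partitioned into a clique and an independent set. *)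

theory Defs
  imports "Graph_Theory.Graph_Theory"
begin

text \<open>
  A finite simple undirected graph is a \<^locale>\<open>pair_graph\<close>: finitely many vertices and a
  symmetric irreflexive set of arcs, so that an edge is represented by both of its orientations.
\<close>

definition open_nbhd :: "'a pair_pre_digraph \<Rightarrow> 'a \<Rightarrow> 'a set" where
  "open_nbhd G v = {u \<in> pverts G. (v, u) \<in> parcs G}"

definition dominating_set :: "'a pair_pre_digraph \<Rightarrow> 'a set \<Rightarrow> bool" where
  "dominating_set G S \<longleftrightarrow>
     S \<subseteq> pverts G \<and> (\<forall>v\<in>pverts G. v \<in> S \<or> (\<exists>u\<in>S. (u, v) \<in> parcs G))"

definition minimal_dominating_set :: "'a pair_pre_digraph \<Rightarrow> 'a set \<Rightarrow> bool" where
  "minimal_dominating_set G S \<longleftrightarrow> dominating_set G S \<and> (\<forall>T. T \<subset> S \<longrightarrow> \<not> dominating_set G T)"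

definition reconf_adjacent :: "'a pair_pre_digraph \<Rightarrow> 'a set \<Rightarrow> 'a set \<Rightarrow> bool" where
  "reconf_adjacent G M1 M2 \<longleftrightarrow>
     (\<exists>v. (M2 - M1 = {v} \<and> M1 - M2 \<subseteq> open_nbhd G v) \<or>
          (M1 - M2 = {v} \<and> M2 - M1 \<subseteq> open_nbhd G v))"

definition reconf_graph :: "'a pair_pre_digraph \<Rightarrow> 'a set pair_pre_digraph" where
  "reconf_graph G =
     \<lparr> pverts = {M. minimal_dominating_set G M},
       parcs = {(M1, M2). minimal_dominating_set G M1 \<and> minimal_dominating_set G M2 \<and>
                          reconf_adjacent G M1 M2} \<rparr>"

definition is_clique :: "'a pair_pre_digraph \<Rightarrow> 'a set \<Rightarrow> bool" where
  "is_clique G C \<longleftrightarrow> C \<subseteq> pverts G \<and> (\<forall>u\<in>C. \<forall>v\<in>C. u \<noteq> v \<longrightarrow> (u, v) \<in> parcs G)"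

definition is_independent :: "'a pair_pre_digraph \<Rightarrow> 'a set \<Rightarrow> bool" where
  "is_independent G I \<longleftrightarrow> I \<subseteq> pverts G \<and> (\<forall>u\<in>I. \<forall>v\<in>I. (u, v) \<notin> parcs G)"

text \<open>As usual for split graphs, either part of the partition may be empty.\<close>

definition split_partition :: "'a pair_pre_digraph \<Rightarrow> 'a set \<Rightarrow> 'a set \<Rightarrow> bool" where
  "split_partition G C I \<longleftrightarrow>
     C \<union> I = pverts G \<and> C \<inter> I = {} \<and> is_clique G C \<and> is_independent G I"

text \<open>
  With unit arc weights, \<^const>\<open>wf_digraph.\<mu>\<close> is the usual distance: the least number of arcs on
  a walk, and \<open>\<infinity>\<close> if there is none.
\<close>

definition graph_dist :: "('a, 'b) pre_digraph \<Rightarrow> 'a \<Rightarrow> 'a \<Rightarrow> ereal" where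
  "graph_dist G u v = wf_digraph.\<mu> G (\<lambda>_. 1) u v"

definition diameter :: "('a, 'b) pre_digraph \<Rightarrow> ereal" where
  "diameter G = (SUP u\<in>verts G. SUP v\<in>verts G. graph_dist G u v)"

lemma (in wf_digraph) awalk_cost_unit: "awalk_cost (\<lambda>_. 1) p = real (length p)"
  by (simp add: awalk_cost_def sum_list_triv)

lemma (in wf_digraph) graph_dist_conv_INF:
  "graph_dist G u v = (INF p\<in>{p. awalk u p v}. ereal (real (length p)))"
  by (simp add: graph_dist_def \<mu>_def awalk_cost_unit)

lemma (in pair_graph) pair_graph_reconf_graph: "pair_graph (reconf_graph G)"
proof -
  have sub: "{M. minimal_dominating_set G M} \<subseteq> Pow (pverts G)"
    by (auto simp: minimal_dominating_set_def dominating_set_def)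
  then have fin: "finite {M. minimal_dominating_set G M}"
    using pair_finite_verts finite_subset by blast
  have "finite (parcs (reconf_graph G))"
    by (rule finite_subset[OF _ finite_cartesian_product[OF fin fin]])
       (auto simp: reconf_graph_def)
  moreover have "sym (parcs (reconf_graph G))"
    by (auto simp: sym_def reconf_graph_def reconf_adjacent_def)
  ultimately show ?thesis
    using fin by unfold_locales
      (auto simp: reconf_graph_def reconf_adjacent_def symmetric_def)
qed

end

theory Submission
  imports Defs
begin

text \<open>
  For a set \<open>D\<close> of clique vertices let \<open>mds D\<close> be \<open>D\<close> together with all independent vertices that
  \<open>D\<close> does not dominate. A minimal dominating set is determined by its clique part \<open>D\<close>: it equals
  \<open>mds D\<close>, and if \<open>D\<close> has at least two elements then each of them has a private neighbour in the
  independent set \<open>I\<close>, so that \<open>card D \<le> max 1 (card I)\<close>. Private neighbours survive when \<open>D\<close>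
  shrinks, hence deleting a vertex from \<open>D\<close> is a reconfiguration step: that vertex is exchanged for
  its private neighbours. If \<open>I\<close> is dominating, everything can thus be moved to \<open>mds {} = I\<close>.
  Otherwise some clique vertex \<open>c\<close> has no neighbour in \<open>I\<close>, and \<open>mds {d}\<close> and
  \<open>mds {c} = insert c I\<close> are adjacent for every other clique vertex \<open>d\<close>. Either way the common
  target is reached in at most \<open>card D\<close> steps. The additional \<open>1\<close> in the bound is needed only for
  \<open>I = {}\<close>, where the minimal dominating sets of a nonempty graph are its single vertices.
\<close>

section \<open>Walks as relational powers, connectedness and diameter\<close>

lemma relpow_sym:
  assumes "sym R" "(x, y) \<in> R ^^ n"
  shows "(y, x) \<in> R ^^ n"
  using assms(2)
proof (induction n arbitrary: y)
  case (Suc n)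
  then obtain z where "(x, z) \<in> R ^^ n" "(z, y) \<in> R" by auto
  then show ?case
    using Suc.IH assms(1) by (meson relpow_Suc_I2 symD)
qed simp

lemma (in pair_wf_digraph) relpow_parcs_imp_awalk:
  assumes "(u, v) \<in> parcs G ^^ n" "v \<in> pverts G"
  shows "\<exists>p. awalk u p v \<and> length p = n"
  using assms(1)
proof (induction n arbitrary: u)
  case 0
  then show ?case using assms(2) by (auto simp: awalk_Nil_iff)
next
  case (Suc n)
  then obtain w where w: "(u, w) \<in> parcs G" "(w, v) \<in> parcs G ^^ n"
    by (meson relpow_Suc_D2)
  then obtain p where "awalk w p v" "length p = n" using Suc.IH by blast
  then show ?case using w(1)
    by (intro exI[of _ "(u, w) # p"]) (simp add: awalk_Cons_iff)
qed

lemma (in wf_digraph) strongly_connected_imp_connected: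
  assumes "strongly_connected G"
  shows "Digraph_Component.connected G"
  using assms by (simp add: Digraph_Component.connected_def strongly_connected_def reachable_mk_symmetricI)

text \<open>Walks of bounded length give strong connectedness, which includes nonemptiness, and
  bound each infimum of walk lengths.\<close>

lemma (in pair_wf_digraph) connected_and_diameter_leI:
  assumes "pverts G \<noteq> {}"
    and "\<And>u v. u \<in> pverts G \<Longrightarrow> v \<in> pverts G \<Longrightarrow> \<exists>k\<le>n. (u, v) \<in> parcs G ^^ k"
  shows "Digraph_Component.connected (with_proj G) \<and> diameter (with_proj G) \<le> ereal (real n)"
proof
  have walk: "\<exists>p. awalk u p v \<and> length p \<le> n" if "u \<in> pverts G" "v \<in> pverts G" for u v
    using assms(2)[OF that] relpow_parcs_imp_awalk that(2) by blast
  show "Digraph_Component.connected (with_proj G)"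
    using assms(1) walk
    by (intro strongly_connected_imp_connected)
       (auto simp: strongly_connected_def reachable_awalk)
  have "graph_dist (with_proj G) u v \<le> ereal (real n)"
    if uv: "u \<in> pverts G" "v \<in> pverts G" for u v
  proof -
    obtain p where "awalk u p v" "length p \<le> n" using walk[OF uv] by blast
    then show ?thesis
      unfolding graph_dist_conv_INF by (intro INF_lower2[of p]) auto
  qed
  then show "diameter (with_proj G) \<le> ereal (real n)"
    unfolding diameter_def by (auto intro!: SUP_least)
qed

section \<open>Domination in arbitrary graphs\<close>

lemma dominating_set_mono:
  assumes "dominating_set G S" "S \<subseteq> T" "T \<subseteq> pverts G"
  shows "dominating_set G T"
  using assms unfolding dominating_set_def by blast

text \<open>Any proper dominating subset of \<open>S\<close> can be enlarged to some
  \<open>S - {v}\<close>, which then dominates as well.\<close>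

lemma minimal_dominating_set_iff:
  "minimal_dominating_set G S \<longleftrightarrow>
     dominating_set G S \<and> (\<forall>v\<in>S. \<not> dominating_set G (S - {v}))"
proof
  assume R: "dominating_set G S \<and> (\<forall>v\<in>S. \<not> dominating_set G (S - {v}))"
  have False if "T \<subset> S" "dominating_set G T" for T
  proof -
    obtain v where v: "v \<in> S" "v \<notin> T" using \<open>T \<subset> S\<close> by blast
    have "S - {v} \<subseteq> pverts G" using R unfolding dominating_set_def by blast
    moreover have "T \<subseteq> S - {v}" using that v by blast
    ultimately have "dominating_set G (S - {v})" using dominating_set_mono that(2) by blast
    then show False using R v by blast
  qed
  then show "minimal_dominating_set G S"
    using R unfolding minimal_dominating_set_def by blast
qed (auto simp: minimal_dominating_set_def)

section \<open>Minimal dominating sets of a split graph and their clique parts\<close>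

locale split_graph = pair_graph G for G :: "'a pair_pre_digraph" +
  fixes C I :: "'a set"
  assumes split: "split_partition G C I"
begin

definition mds :: "'a set \<Rightarrow> 'a set" where
  "mds D = D \<union> {i \<in> I. \<forall>d\<in>D. (d, i) \<notin> parcs G}"

text \<open>This characterises the clique parts of minimal dominating sets. The clause for
  \<open>D = {}\<close> says that \<open>I\<close> dominates the clique. Quantifying over a second
  element \<open>e\<close> exempts singletons: a lone clique vertex is undominated once removed, so
  it needs no private neighbour in \<open>I\<close>.\<close>

definition admissible :: "'a set \<Rightarrow> bool" where
  "admissible D \<longleftrightarrow> D \<subseteq> C \<and> (D = {} \<longrightarrow> (\<forall>c\<in>C. \<exists>i\<in>I. (i, c) \<in> parcs G)) \<and>
     (\<forall>d\<in>D. \<forall>e\<in>D. d \<noteq> e \<longrightarrow>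
        (\<exists>i\<in>I. (d, i) \<in> parcs G \<and> (\<forall>f\<in>D. (f, i) \<in> parcs G \<longrightarrow> f = d)))"

lemma verts_eq: "pverts G = C \<union> I" and disj: "C \<inter> I = {}"
  using split unfolding split_partition_def by auto

lemma clique: "u \<in> C \<Longrightarrow> v \<in> C \<Longrightarrow> u \<noteq> v \<Longrightarrow> (u, v) \<in> parcs G"
  using split unfolding split_partition_def is_clique_def by auto

lemma indep: "u \<in> I \<Longrightarrow> v \<in> I \<Longrightarrow> (u, v) \<notin> parcs G"
  using split unfolding split_partition_def is_independent_def by auto

lemma parcs_sym: "(u, v) \<in> parcs G \<Longrightarrow> (v, u) \<in> parcs G"
  using arcs_symmetric by (simp add: symmetric_conv)

lemma finite_parts: "finite C" "finite I"
  using pair_finite_verts unfolding verts_eq by auto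

lemma admissible_subset: "admissible D \<Longrightarrow> D \<subseteq> C"
  by (simp add: admissible_def)

lemma admissible_empty_iff: "admissible {} \<longleftrightarrow> (\<forall>c\<in>C. \<exists>i\<in>I. (i, c) \<in> parcs G)"
  by (simp add: admissible_def)

lemma admissible_finite: "admissible D \<Longrightarrow> finite D"
  using finite_parts(1) finite_subset admissible_subset by blast

lemma dominating_set_if_clique_vertex:
  assumes "S \<subseteq> pverts G" "c \<in> S" "c \<in> C"
    and "\<And>i. i \<in> I \<Longrightarrow> i \<notin> S \<Longrightarrow> \<exists>u\<in>S. (u, i) \<in> parcs G"
  shows "dominating_set G S"
  using assms clique unfolding dominating_set_def verts_eq by blast

lemma admissible_private:
  assumes "admissible D" "d \<in> D" "e \<in> D" "d \<noteq> e"
  shows "\<exists>i\<in>I. (d, i) \<in> parcs G \<and> (\<forall>f\<in>D. (f, i) \<in> parcs G \<longrightarrow> f = d)"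
proof -
  have "\<forall>d\<in>D. \<forall>e\<in>D. d \<noteq> e \<longrightarrow>
      (\<exists>i\<in>I. (d, i) \<in> parcs G \<and> (\<forall>f\<in>D. (f, i) \<in> parcs G \<longrightarrow> f = d))"
    using assms(1) unfolding admissible_def by (elim conjE)
  from mp[OF bspec[OF bspec[OF this assms(2)] assms(3)] assms(4)] show ?thesis .
qed

lemma minimal_dominating_set_mds:
  assumes "admissible D"
  shows "minimal_dominating_set G (mds D)"
  unfolding minimal_dominating_set_iff
proof
  have DC: "D \<subseteq> C" using assms by (rule admissible_subset)
  show "dominating_set G (mds D)"
  proof (cases "D = {}")
    case True
    then have "mds D = I" by (auto simp: mds_def)
    then show ?thesis
      using True assms by (auto simp: dominating_set_def admissible_empty_iff verts_eq)
  next
    case False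
    then obtain d where "d \<in> D" by blast
    then show ?thesis
      using DC by (intro dominating_set_if_clique_vertex[of _ d]) (auto simp: mds_def verts_eq)
  qed
  show "\<forall>v\<in>mds D. \<not> dominating_set G (mds D - {v})"
  proof
    fix v assume v: "v \<in> mds D"
    have "v \<in> pverts G" using v DC by (auto simp: mds_def verts_eq)
    \<comment> \<open>The witness \<open>w\<close> is a private neighbour of \<open>v\<close> in
      \<open>I\<close> if \<open>D\<close> has an element besides \<open>v\<close>, and
      \<open>v\<close> itself otherwise.\<close>
    have "\<exists>w\<in>pverts G. w \<notin> mds D - {v} \<and> (\<forall>u\<in>mds D - {v}. (u, w) \<notin> parcs G)"
    proof (cases "v \<in> D \<and> D \<noteq> {v}")
      case True
      then obtain e where "e \<in> D" "v \<noteq> e" by blast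
      then obtain i where "i \<in> I" "(v, i) \<in> parcs G" "\<forall>f\<in>D. (f, i) \<in> parcs G \<longrightarrow> f = v"
        using admissible_private[OF assms, of v e] True by blast
      then show ?thesis
        using True DC disj indep by (intro bexI[of _ i]) (auto simp: mds_def verts_eq)
    next
      case False
      then have "\<forall>u\<in>mds D - {v}. (u, v) \<notin> parcs G"
        using v indep parcs_sym[of _ v] by (auto simp: mds_def)
      then show ?thesis
        using \<open>v \<in> pverts G\<close> by blast
    qed
    then show "\<not> dominating_set G (mds D - {v})"
      unfolding dominating_set_def by blast
  qed
qed

lemma minimal_dominating_setE:
  assumes "minimal_dominating_set G S"
  obtains D where "admissible D" "S = mds D"
proof
  let ?D = "S \<inter> C"
  have dom: "dominating_set G S" and min: "\<And>v. v \<in> S \<Longrightarrow> \<not> dominating_set G (S - {v})"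
    using assms unfolding minimal_dominating_set_iff by auto
  then have S: "S \<subseteq> C \<union> I" by (simp add: dominating_set_def verts_eq)
  have domI: "\<exists>d\<in>?D. (d, i) \<in> parcs G" if "i \<in> I" "i \<notin> S" for i
    using dom S that indep unfolding dominating_set_def verts_eq by blast
  \<comment> \<open>Such an \<open>i\<close> is redundant: \<open>d\<close> dominates it and the
    whole clique, and by independence \<open>i\<close> dominates nothing else in
    \<open>I\<close>.\<close>
  have notdom: False if "i \<in> S" "i \<in> I" "d \<in> ?D" "(d, i) \<in> parcs G" for i d
  proof -
    have "d \<noteq> i" using that disj by blast
    have "dominating_set G (S - {i})"
    proof (rule dominating_set_if_clique_vertex[of _ d])
      fix j assume j: "j \<in> I" "j \<notin> S - {i}"
      show "\<exists>u\<in>S - {i}. (u, j) \<in> parcs G"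
      proof (cases "j = i")
        case True
        then show ?thesis using that \<open>d \<noteq> i\<close> by blast
      next
        case False
        then obtain u where "u \<in> ?D" "(u, j) \<in> parcs G" using domI j by blast
        moreover have "u \<noteq> i" using calculation that disj by blast
        ultimately show ?thesis by blast
      qed
    qed (use S that \<open>d \<noteq> i\<close> verts_eq in auto)
    then show False using min that by blast
  qed
  show "S = mds ?D"
    using S domI notdom unfolding mds_def by blast
  have "\<exists>i\<in>I. (d, i) \<in> parcs G \<and> (\<forall>f\<in>?D. (f, i) \<in> parcs G \<longrightarrow> f = d)"
    if "d \<in> ?D" "e \<in> ?D" "d \<noteq> e" for d e
  proof -
    \<comment> \<open>Since \<open>e\<close> still dominates the clique, a vertex left undominated
      by \<open>S - {d}\<close> must lie in \<open>I\<close>.\<close>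
    have "\<exists>i\<in>I. i \<notin> S - {d} \<and> (\<forall>u\<in>S - {d}. (u, i) \<notin> parcs G)"
    proof (rule ccontr)
      assume "\<not> ?thesis"
      then have "dominating_set G (S - {d})"
        using that S by (intro dominating_set_if_clique_vertex[of _ e]) (auto simp: verts_eq)
      then show False using min that by blast
    qed
    then obtain i where i: "i \<in> I" "i \<notin> S - {d}" "\<forall>u\<in>S - {d}. (u, i) \<notin> parcs G"
      by blast
    moreover have "i \<notin> S" using i that disj by blast
    ultimately show ?thesis using domI by blast
  qed
  moreover have "\<exists>i\<in>I. (i, c) \<in> parcs G" if "?D = {}" "c \<in> C" for c
    using dom S that unfolding dominating_set_def verts_eq by blast
  ultimately show "admissible ?D"
    unfolding admissible_def by blast
qed

lemma minimal_dominating_set_iff_mds: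
  "minimal_dominating_set G S \<longleftrightarrow> (\<exists>D. admissible D \<and> S = mds D)"
  using minimal_dominating_set_mds minimal_dominating_setE by metis

text \<open>Choosing private neighbours is injective. The maximum with 1 covers singletons, which
  are admissible even if \<open>I\<close> is empty.\<close>

lemma card_admissible_le:
  assumes "admissible D"
  shows "card D \<le> max 1 (card I)"
proof (cases "\<exists>d\<in>D. \<exists>e\<in>D. d \<noteq> e")
  case True
  then have "\<forall>d\<in>D. \<exists>i\<in>I. (d, i) \<in> parcs G \<and> (\<forall>f\<in>D. (f, i) \<in> parcs G \<longrightarrow> f = d)"
    using admissible_private[OF assms] by metis
  then obtain p where
    p: "\<forall>d\<in>D. p d \<in> I \<and> (d, p d) \<in> parcs G \<and> (\<forall>f\<in>D. (f, p d) \<in> parcs G \<longrightarrow> f = d)"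
    by metis
  have "inj_on p D" by (rule inj_onI) (metis p)
  moreover have "p ` D \<subseteq> I" using p by blast
  ultimately have "card D \<le> card I" using finite_parts(2) by (rule card_inj_on_le)
  then show ?thesis by simp
next
  case False
  then have "card D \<le> 1"
    by (metis card_le_Suc0_iff_eq[OF admissible_finite[OF assms]] One_nat_def)
  then show ?thesis by simp
qed

section \<open>Reconfiguration steps and paths\<close>

lemma reconf_arcI:
  assumes "admissible D" "admissible E" "mds D - mds E = {v}" "mds E - mds D \<subseteq> open_nbhd G v"
  shows "(mds D, mds E) \<in> parcs (reconf_graph G)"
  using assms minimal_dominating_set_mds
  by (auto simp: reconf_graph_def reconf_adjacent_def)

text \<open>The independent vertices that enter had \<open>d\<close> as their only neighbour in
  \<open>D\<close>, so they lie in its neighbourhood.\<close>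

lemma reconf_arc_remove:
  assumes "admissible D" "admissible (D - {d})" "d \<in> D"
  shows "(mds D, mds (D - {d})) \<in> parcs (reconf_graph G)"
proof (rule reconf_arcI)
  have "d \<notin> I" using admissible_subset[OF assms(1)] assms(3) disj by blast
  then show "mds D - mds (D - {d}) = {d}" using assms by (auto simp: mds_def)
  show "mds (D - {d}) - mds D \<subseteq> open_nbhd G d"
    using assms by (auto simp: mds_def open_nbhd_def verts_eq)
qed (use assms in auto)

lemma admissible_remove:
  assumes "admissible D" "D - {d} \<noteq> {}"
  shows "admissible (D - {d})"
proof -
  have "\<exists>i\<in>I. (e, i) \<in> parcs G \<and> (\<forall>g\<in>D - {d}. (g, i) \<in> parcs G \<longrightarrow> g = e)"
    if "e \<in> D - {d}" "f \<in> D - {d}" "e \<noteq> f" for e f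
  proof -
    have "\<exists>i\<in>I. (e, i) \<in> parcs G \<and> (\<forall>g\<in>D. (g, i) \<in> parcs G \<longrightarrow> g = e)"
      using assms(1) that by (intro admissible_private[of D e f]) auto
    then show ?thesis by blast
  qed
  moreover have "D - {d} \<subseteq> C" using admissible_subset[OF assms(1)] by blast
  ultimately show ?thesis using assms(2) unfolding admissible_def by simp
qed

lemma admissible_singleton: "c \<in> C \<Longrightarrow> admissible {c}"
  by (simp add: admissible_def)

lemma reach_independent_part:
  assumes "admissible {}" "admissible D"
  shows "(mds D, mds {}) \<in> parcs (reconf_graph G) ^^ card D"
proof -
  have "finite D" using assms by (simp add: admissible_finite)
  then show ?thesis
    using assms(2)
  proof (induction D rule: finite_psubset_induct)
    case (psubset D)
    show ?case
    proof (cases "D = {}")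
      case False
      then obtain d where d: "d \<in> D" by blast
      have adm: "admissible (D - {d})"
        using admissible_remove psubset.prems assms(1) by metis
      have "(mds (D - {d}), mds {}) \<in> parcs (reconf_graph G) ^^ card (D - {d})"
        using psubset.IH adm d by blast
      then have "(mds D, mds {}) \<in> parcs (reconf_graph G) ^^ Suc (card (D - {d}))"
        using reconf_arc_remove[OF psubset.prems adm d] by (rule relpow_Suc_I2[rotated])
      then show ?thesis
        unfolding card_Suc_Diff1[OF psubset.hyps(1) d] .
    qed simp
  qed
qed

lemma reach_isolated_clique_vertex:
  assumes "c \<in> C" "\<forall>i\<in>I. (i, c) \<notin> parcs G" "admissible D"
  shows "\<exists>k\<le>card D. (mds D, mds {c}) \<in> parcs (reconf_graph G) ^^ k"
proof -
  have "finite D" using assms by (simp add: admissible_finite)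
  then show ?thesis
    using assms(3)
  proof (induction D rule: finite_psubset_induct)
    case (psubset D)
    have "D \<noteq> {}" using psubset.prems assms(1,2) admissible_empty_iff by blast
    then obtain d where d: "d \<in> D" by blast
    show ?case
    proof (cases "D = {d}")
      case True
      show ?thesis
      proof (cases "d = c")
        case dc: True
        then show ?thesis using True by (intro exI[of _ 0]) auto
      next
        case False
        have "d \<in> C" using admissible_subset[OF psubset.prems] d by blast
        \<comment> \<open>As \<open>c\<close> has no neighbour in \<open>I\<close>,
          \<open>mds {c}\<close> contains all of \<open>I\<close>; only \<open>d\<close> leaves, and
          what enters is \<open>c\<close> or a neighbour of \<open>d\<close> in
          \<open>I\<close>.\<close>
        have "(mds {d}, mds {c}) \<in> parcs (reconf_graph G)"
        proof (rule reconf_arcI)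
          have "d \<notin> I" using \<open>d \<in> C\<close> disj by blast
          then show "mds {d} - mds {c} = {d}"
            using False assms(2) parcs_sym[of c] by (auto simp: mds_def)
          show "mds {c} - mds {d} \<subseteq> open_nbhd G d"
            using False clique \<open>d \<in> C\<close> assms(1) by (auto simp: mds_def open_nbhd_def verts_eq)
        qed (use admissible_singleton \<open>d \<in> C\<close> assms(1) in auto)
        then show ?thesis using True by (intro exI[of _ 1]) auto
      qed
    next
      case False
      then have adm: "admissible (D - {d})"
        using admissible_remove psubset.prems d by blast
      obtain k where k: "k \<le> card (D - {d})"
        "(mds (D - {d}), mds {c}) \<in> parcs (reconf_graph G) ^^ k"
        using psubset.IH[OF _ adm] d by blast
      then have "(mds D, mds {c}) \<in> parcs (reconf_graph G) ^^ Suc k"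
        using reconf_arc_remove[OF psubset.prems adm d] by (rule_tac relpow_Suc_I2)
      \<comment> \<open>Reaching a singleton takes \<open>card D - 1\<close> removals, which leaves
        room for one final exchange with \<open>c\<close>.\<close>
      moreover have "Suc k \<le> card D"
        using k(1) d psubset.hyps card_Suc_Diff1 by fastforce
      ultimately show ?thesis by blast
    qed
  qed
qed

lemma reconf_graph_path:
  assumes "admissible D" "admissible E"
  shows "\<exists>k\<le>2 * card I + 1. (mds D, mds E) \<in> parcs (reconf_graph G) ^^ k"
proof -
  let ?R = "parcs (reconf_graph G)"
  have sym: "sym ?R"
    by (auto simp: sym_def reconf_graph_def reconf_adjacent_def)
  have via: ?thesis
    if "(mds D, M) \<in> ?R ^^ k" "(mds E, M) \<in> ?R ^^ l" "k + l \<le> 2 * card I + 1" for M k l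
  proof -
    have "(mds D, mds E) \<in> ?R ^^ (k + l)"
      unfolding relpow_add using that(1) relpow_sym[OF sym that(2)] by blast
    then show ?thesis using that(3) by blast
  qed
  \<comment> \<open>For nonempty \<open>I\<close> the maximum with 1 in the cardinality bound
    disappears.\<close>
  have bound: "card D + card E \<le> 2 * card I" if "I \<noteq> {}"
  proof -
    have "card I \<ge> 1" using that finite_parts(2) by (simp add: Suc_leI card_gt_0_iff)
    then show ?thesis
      using card_admissible_le[OF assms(1)] card_admissible_le[OF assms(2)] by simp
  qed
  show ?thesis
  proof (cases "admissible {}")
    case True
    have "card D + card E \<le> 2 * card I"
    proof (cases "I = {}")
      case I: True
      then have "C = {}" using True admissible_empty_iff by blast
      then show ?thesis using admissible_subset[OF assms(1)] admissible_subset[OF assms(2)] by simp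
    qed (rule bound)
    then show ?thesis
      using via[OF reach_independent_part[OF True assms(1)] reach_independent_part[OF True assms(2)]]
      by simp
  next
    case False
    then obtain c where c: "c \<in> C" "\<forall>i\<in>I. (i, c) \<notin> parcs G"
      by (auto simp: admissible_empty_iff)
    show ?thesis
    proof (cases "I = {}")
      case True
      have "card D \<le> 1" "card E \<le> 1"
        using card_admissible_le[OF assms(1)] card_admissible_le[OF assms(2)] True by auto
      moreover have "E \<noteq> {}" using False assms(2) by blast
      \<comment> \<open>A detour through \<open>mds {c}\<close> could cost two steps, one too many
        here. With \<open>I\<close> empty every clique vertex qualifies as target, so the single
        vertex \<open>e\<close> of \<open>E\<close> is used instead.\<close>
      ultimately have "card E = 1"
        using admissible_finite[OF assms(2)] card_gt_0_iff[of E] by linarith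
      then obtain e where e: "E = {e}" by (rule card_1_singletonE)
      then have "e \<in> C" using admissible_subset[OF assms(2)] by simp
      then obtain k where "k \<le> card D" "(mds D, mds E) \<in> ?R ^^ k"
        using reach_isolated_clique_vertex[of e] assms(1) True e by blast
      then show ?thesis using \<open>card D \<le> 1\<close> by (intro exI[of _ k]) auto
    next
      case I: False
      obtain k l where "k \<le> card D" "(mds D, mds {c}) \<in> ?R ^^ k"
        "l \<le> card E" "(mds E, mds {c}) \<in> ?R ^^ l"
        using reach_isolated_clique_vertex[OF c] assms by meson
      then show ?thesis using via[of "mds {c}" k l] bound[OF I] by simp
    qed
  qed
qed

end

theorem theorem12:
  fixes G :: "'a pair_pre_digraph" and C\<^sub>G I\<^sub>G :: "'a set"
  assumes "pair_graph G"
    and "split_partition G C\<^sub>G I\<^sub>G"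
  shows "Digraph_Component.connected (with_proj (reconf_graph G)) \<and>
         diameter (with_proj (reconf_graph G)) \<le> ereal (real (2 * card I\<^sub>G + 1))"
proof -
  interpret G: pair_graph G by fact
  interpret split_graph G C\<^sub>G I\<^sub>G by unfold_locales fact
  interpret R: pair_graph "reconf_graph G" by (rule G.pair_graph_reconf_graph)
  have verts: "M \<in> pverts (reconf_graph G) \<longleftrightarrow> (\<exists>D. admissible D \<and> M = mds D)" for M
    by (simp add: reconf_graph_def minimal_dominating_set_iff_mds)
  \<comment> \<open>Connectedness requires a nonempty reconfiguration graph.\<close>
  have "\<exists>D. admissible D"
  proof (cases "C\<^sub>G = {}")
    case True
    then have "admissible {}" using admissible_empty_iff by blast
    then show ?thesis ..
  next
    case False
    then show ?thesis using admissible_singleton by blast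
  qed
  then have "pverts (reconf_graph G) \<noteq> {}" using verts by blast
  then show ?thesis
    using verts reconf_graph_path by (intro R.connected_and_diameter_leI) auto
qed

end
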